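(* Let $a_{05},a_{14},a_{23},a_{32},a_{41},a_{50}\in\mathbb{R}$ and consider the polynomial differential system in the plane $\mathbb{R}^2$ $$\dot{x}= y,\qquad \dot{y}=-x+a_{05}\,y^5+a_{14}\,x\,y^4+a_{23}\,x^2\,y^3+a_{32}\,x^3\,y^2+a_{41}\,x^4\,y+a_{50}\,x^5.$$ This system has a global center at the origin of coordinates if and only if $$a_{32}\leq 0,\qquad a_{50}\leq 0,\qquad\text{and}\qquad a_{14}=a_{41}=a_{23}=a_{05}=0.$$
   Context: The dot denotes the derivative with respect to the time $t$. A center of a differential system in $\mathbb{R}^2$ is an equilibrium point $p$ having a neighborhood $U$ such that $U\setminus\{p\}$ is filled with periodic orbits (i.e. every point of $U\setminus\{p\}$ lies on a non-constant periodic orbit). A center $p$ is global when $\mathbb{R}^2\setminus\{p\}$ is filled with periodic orbits. *)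

theory Defs
  imports "HOL-Analysis.Analysis"
begin

definition global_solution :: "('a::real_normed_vector \<Rightarrow> 'a) \<Rightarrow> (real \<Rightarrow> 'a) \<Rightarrow> bool" where
  "global_solution f \<gamma> \<longleftrightarrow> (\<forall>t. (\<gamma> has_vector_derivative f (\<gamma> t)) (at t))"

definition periodic_orbit :: "('a::real_normed_vector \<Rightarrow> 'a) \<Rightarrow> 'a set \<Rightarrow> bool" where
  "periodic_orbit f C \<longleftrightarrow>
     (\<exists>\<gamma> T. global_solution f \<gamma> \<and> T > 0 \<and> (\<forall>t. \<gamma> (t + T) = \<gamma> t) \<and>
        \<not> \<gamma> constant_on UNIV \<and> C = range \<gamma>)"

(* The orbit through a point of S is not required to stay inside S. *)
definition filled_with_periodic_orbits ::
    "('a::real_normed_vector \<Rightarrow> 'a) \<Rightarrow> 'a set \<Rightarrow> bool" where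
  "filled_with_periodic_orbits f S \<longleftrightarrow> (\<forall>q\<in>S. \<exists>C. periodic_orbit f C \<and> q \<in> C)"

definition is_center :: "(real \<times> real \<Rightarrow> real \<times> real) \<Rightarrow> real \<times> real \<Rightarrow> bool" where
  "is_center f p \<longleftrightarrow>
     f p = 0 \<and> (\<exists>U. open U \<and> p \<in> U \<and> filled_with_periodic_orbits f (U - {p}))"

definition is_global_center :: "(real \<times> real \<Rightarrow> real \<times> real) \<Rightarrow> real \<times> real \<Rightarrow> bool" where
  "is_global_center f p \<longleftrightarrow> is_center f p \<and> filled_with_periodic_orbits f (UNIV - {p})"

definition quintic_field ::
    "real \<Rightarrow> real \<Rightarrow> real \<Rightarrow> real \<Rightarrow> real \<Rightarrow> real \<Rightarrow> real \<times> real \<Rightarrow> real \<times> real" where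
  "quintic_field a05 a14 a23 a32 a41 a50 = (\<lambda>(x, y).
     (y,
      - x + a05 * y ^ 5 + a14 * x * y ^ 4 + a23 * x ^ 2 * y ^ 3
        + a32 * x ^ 3 * y ^ 2 + a41 * x ^ 4 * y + a50 * x ^ 5))"

end

theory Submission
  imports Defs
begin

text \<open>
  The system is the Newton equation x'' = F x x' on the line, with velocity y = x'.

  Necessity: since \<^emph>\<open>every\<close> orbit is assumed periodic, one orbit that never returns
  excludes a choice of signs. For all coefficients except a41, such an orbit starts in a closed region of the half plane y > 0 whose boundary the flow crosses only inwards; inside it x
  increases forever (\<open>rightward_trap_not_all_periodic\<close>). If on some strip
  l \<le> x \<le> r the force is at least c y^3 for large y, then dx/dy \<le> 1/(c y^2) is
  integrable at infinity, so an orbit can run to y = \<infinity> before x reaches r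
  (\<open>cubic_force_not_all_periodic\<close>). As F has terms of degree 5, 4 and 3 in y, this applies
  when a05 > 0, when a05 = 0 and a14 is nonzero (on a strip where a14 x > 0), and when
  a05 = a14 = 0 and a23 > 0. The reversal (x, y, t) \<mapsto> (x, -y, -t) flips the signs of a05,
  a23 and a41 and so disposes of negative a05 and a23. What is left is
  x'' = -x + a32 x^3 x'^2 + a41 x^4 x' + a50 x^5. For a41 = 0 its orbits satisfy a linear equation
  for y^2 as a function of x, whence the first integral
  H = y^2/2 exp(-a32 x^4/2) + G x. For general a41 the derivative of H along the flow has the
  sign of a41, so H would be strictly monotone on a periodic orbit unless a41 = 0. Finally, a
  positive a32 lets orbits escape in a sector y \<ge> k x, and a positive a50 in a quadrant.

  Sufficiency: for a32, a50 \<le> 0 the function G, with G 0 = 0, is even and strictly increasing on x \<ge> 0, so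
  u = sgn x sqrt (2 G x) is a coordinate on the whole line
  (\<open>square_root_coordinate\<close>). With w = y exp(-a32 x^4/4) the integral H is
  (u^2 + w^2)/2, and in the (u, w) plane orbits are circles run through with a positive angular
  speed that depends on the position only. The angle therefore solves a scalar autonomous equation,
  integrated by inverting a quadrature (\<open>phase_equation_solution\<close>); this yields the
  periodic solutions explicitly (\<open>all_periodic_of_energy_coordinates\<close>).
\<close>

section \<open>Planar fields with x as position and y as velocity\<close>

definition newton_field :: "(real \<Rightarrow> real \<Rightarrow> real) \<Rightarrow> real \<times> real \<Rightarrow> real \<times> real" where
  "newton_field F = (\<lambda>(x, y). (y, F x y))"

definition newton_solution ::
    "(real \<Rightarrow> real \<Rightarrow> real) \<Rightarrow> (real \<Rightarrow> real) \<Rightarrow> (real \<Rightarrow> real) \<Rightarrow> bool" where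
  "newton_solution F X Y \<longleftrightarrow>
     (\<forall>t. (X has_real_derivative Y t) (at t)) \<and>
     (\<forall>t. (Y has_real_derivative F (X t) (Y t)) (at t))"

definition all_periodic :: "(real \<Rightarrow> real \<Rightarrow> real) \<Rightarrow> bool" where
  "all_periodic F \<longleftrightarrow> filled_with_periodic_orbits (newton_field F) (UNIV - {(0, 0)})"

lemma global_solution_newton_iff:
  "global_solution (newton_field F) (\<lambda>t. (X t, Y t)) \<longleftrightarrow> newton_solution F X Y"
proof
  assume *: "global_solution (newton_field F) (\<lambda>t. (X t, Y t))"
  have "((\<lambda>t. (X t, Y t)) has_vector_derivative (Y t, F (X t) (Y t))) (at t)" for t
    using * by (auto simp: global_solution_def newton_field_def)
  note D = this
  have "(X has_vector_derivative Y t) (at t)" for t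
    using bounded_linear.has_vector_derivative[OF bounded_linear_fst D[of t]] by simp
  moreover have "(Y has_vector_derivative F (X t) (Y t)) (at t)" for t
    using bounded_linear.has_vector_derivative[OF bounded_linear_snd D[of t]] by simp
  ultimately show "newton_solution F X Y"
    by (simp add: newton_solution_def has_real_derivative_iff_has_vector_derivative)
next
  assume "newton_solution F X Y"
  then show "global_solution (newton_field F) (\<lambda>t. (X t, Y t))"
    by (auto simp: global_solution_def newton_field_def newton_solution_def
        has_real_derivative_iff_has_vector_derivative intro: has_vector_derivative_Pair)
qed

text \<open>
  Not only the pair (X, Y) but already X is nonconstant, because Y is the derivative of X. Time is
  shifted so that the solution starts at the given point.
\<close>

lemma periodic_orbit_newtonE:
  assumes "periodic_orbit (newton_field F) C" and "(x0, y0) \<in> C"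
  obtains X Y T where "newton_solution F X Y" "X 0 = x0" "Y 0 = y0" "T > 0"
    "\<And>t. X (t + T) = X t" "\<And>t. Y (t + T) = Y t" "\<not> X constant_on UNIV"
proof -
  obtain \<gamma> T where sol: "global_solution (newton_field F) \<gamma>" and T: "T > 0"
    and per: "\<And>t. \<gamma> (t + T) = \<gamma> t" and nc: "\<not> \<gamma> constant_on UNIV" and C: "C = range \<gamma>"
    using assms(1) by (auto simp: periodic_orbit_def)
  obtain t0 where t0: "\<gamma> t0 = (x0, y0)"
    using assms(2) C by auto
  define X Y where "X = (\<lambda>t. fst (\<gamma> (t + t0)))" and "Y = (\<lambda>t. snd (\<gamma> (t + t0)))"
  have "newton_solution F (\<lambda>t. fst (\<gamma> t)) (\<lambda>t. snd (\<gamma> t))"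
    using sol global_solution_newton_iff[of F "\<lambda>t. fst (\<gamma> t)" "\<lambda>t. snd (\<gamma> t)"] by simp
  then have "newton_solution F X Y"
    unfolding newton_solution_def X_def Y_def
    using DERIV_shift[where z = t0 and f = "\<lambda>t. fst (\<gamma> t)"]
      DERIV_shift[where z = t0 and f = "\<lambda>t. snd (\<gamma> t)"] by blast
  moreover have "\<not> X constant_on UNIV"
  proof
    assume "X constant_on UNIV"
    then obtain c where c: "\<And>t. X t = c"
      by (auto simp: constant_on_def)
    then have "X = (\<lambda>t. c)"
      by auto
    then have "Y t = 0" for t
      using \<open>newton_solution F X Y\<close> DERIV_unique[of X "Y t" t 0]
      by (auto simp: newton_solution_def)
    then have "\<gamma> t = (c, 0)" for t
      using c[of "t - t0"] by (metis X_def Y_def diff_add_cancel prod.collapse)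
    then show False
      using nc by (auto simp: constant_on_def)
  qed
  moreover have "X (t + T) = X t" "Y (t + T) = Y t" for t
    using per[of "t + t0"] by (simp_all add: X_def Y_def algebra_simps)
  ultimately show thesis
    using that T t0 by (simp add: X_def Y_def)
qed

lemma newton_periodicI:
  assumes "newton_solution F X Y" "T > 0" "\<And>t. X (t + T) = X t" "\<And>t. Y (t + T) = Y t"
    "\<not> X constant_on UNIV"
  shows "\<exists>C. periodic_orbit (newton_field F) C \<and> (X t, Y t) \<in> C"
proof -
  have "\<not> (\<lambda>t. (X t, Y t)) constant_on UNIV"
    using assms(5) by (auto simp: constant_on_def)
  then have "periodic_orbit (newton_field F) (range (\<lambda>t. (X t, Y t)))"
    unfolding periodic_orbit_def using assms(1-4) global_solution_newton_iff by blast
  then show ?thesis by blast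
qed

text \<open>
  The map (x, y, t) \<mapsto> (x, -y, -t) preserves the equation x' = y and turns y' = F x y into
  y' = F x (-y), so bounds on F proved for y > 0 can also be used for y < 0.
\<close>

lemma all_periodic_reverse:
  assumes "all_periodic F"
  shows "all_periodic (\<lambda>x y. F x (- y))"
  unfolding all_periodic_def filled_with_periodic_orbits_def
proof
  fix q :: "real \<times> real" assume "q \<in> UNIV - {(0, 0)}"
  moreover obtain x0 y0 where q: "q = (x0, y0)" by force
  ultimately have "(x0, - y0) \<in> UNIV - {(0, 0)}" by auto
  then obtain X Y T where sol: "newton_solution F X Y" and init: "X 0 = x0" "Y 0 = - y0"
    and T: "T > 0" and per: "\<And>t. X (t + T) = X t" "\<And>t. Y (t + T) = Y t"
    and nc: "\<not> X constant_on UNIV"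
    using assms unfolding all_periodic_def filled_with_periodic_orbits_def
    by (metis periodic_orbit_newtonE)
  have DX: "(X has_real_derivative Y t) (at t)" and DY: "(Y has_real_derivative F (X t) (Y t)) (at t)" for t
    using sol by (auto simp: newton_solution_def)
  have "newton_solution (\<lambda>x y. F x (- y)) (\<lambda>t. X (- t)) (\<lambda>t. - Y (- t))"
    unfolding newton_solution_def
  proof (intro conjI allI)
    fix t
    have "((\<lambda>t. X (- t)) has_real_derivative Y (- t) * (- 1)) (at t)"
      by (rule DERIV_chain2[OF DX]) (auto intro!: derivative_eq_intros)
    then show "((\<lambda>t. X (- t)) has_real_derivative - Y (- t)) (at t)" by simp
    have "((\<lambda>t. Y (- t)) has_real_derivative F (X (- t)) (Y (- t)) * (- 1)) (at t)"
      by (rule DERIV_chain2[OF DY]) (auto intro!: derivative_eq_intros)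
    from DERIV_minus[OF this]
    show "((\<lambda>t. - Y (- t)) has_real_derivative F (X (- t)) (- (- Y (- t)))) (at t)" by simp
  qed
  moreover have "X (- (t + T)) = X (- t)" "- Y (- (t + T)) = - Y (- t)" for t
    using per[of "- (t + T)"] by (simp_all add: algebra_simps)
  moreover have "\<not> (\<lambda>t. X (- t)) constant_on UNIV"
    using nc unfolding constant_on_def by (metis UNIV_I minus_minus)
  ultimately have "\<exists>C. periodic_orbit (newton_field (\<lambda>x y. F x (- y))) C \<and>
      (X (- 0), - Y (- 0)) \<in> C"
    using newton_periodicI[of _ "\<lambda>t. X (- t)" "\<lambda>t. - Y (- t)", OF _ T] by blast
  then show "\<exists>C. periodic_orbit (newton_field (\<lambda>x y. F x (- y))) C \<and> q \<in> C"
    using init q by simp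
qed

section \<open>Regions from which solutions cannot return\<close>

text \<open>
  The infimum of the times at which P fails would satisfy P by closedness, and then P would persist
  a little longer.
\<close>

lemma real_continuation_induct:
  fixes P :: "real \<Rightarrow> bool"
  assumes cl: "closed {t. P t}" and init: "P 0"
    and step: "\<And>t. t \<ge> 0 \<Longrightarrow> P t \<Longrightarrow> eventually P (at_right t)"
    and "t \<ge> 0"
  shows "P t"
proof (rule ccontr)
  assume "\<not> P t"
  define N where "N = {s. 0 \<le> s \<and> \<not> P s}"
  define \<tau> where "\<tau> = Inf N"
  have ne: "N \<noteq> {}" and bb: "bdd_below N"
    using \<open>t \<ge> 0\<close> \<open>\<not> P t\<close> by (auto simp: N_def intro: bdd_belowI[of _ 0])
  have \<tau>0: "\<tau> \<ge> 0"
    unfolding \<tau>_def using ne by (intro cInf_greatest) (auto simp: N_def)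
  have before: "P s" if "0 \<le> s" "s < \<tau>" for s
    using cInf_lower[OF _ bb, of s] that by (auto simp: N_def \<tau>_def)
  have "P \<tau>"
  proof (cases "\<tau> = 0")
    case False
    then have "{0<..<\<tau>} \<subseteq> {t. P t}" and "0 < \<tau>"
      using before \<tau>0 by auto
    then have "closure {0<..<\<tau>} \<subseteq> {t. P t}"
      using cl closure_minimal by blast
    then show ?thesis
      using \<open>0 < \<tau>\<close> by (auto simp: closure_greaterThanLessThan subset_iff)
  qed (use init in simp)
  then obtain b where b: "b > \<tau>" "\<And>s. \<tau> < s \<Longrightarrow> s < b \<Longrightarrow> P s"
    using step[OF \<tau>0] by (auto simp: eventually_at_right_field)
  have "b \<le> Inf N"
  proof (rule cInf_greatest[OF ne])
    fix s assume "s \<in> N"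
    then show "b \<le> s"
      using before[of s] b(2)[of s] \<open>P \<tau>\<close>
      by (cases s \<tau> rule: linorder_cases) (auto simp: N_def intro: leI)
  qed
  then show False
    using b(1) by (simp add: \<tau>_def)
qed

text \<open>
  This is how membership in a region g \<ge> 0 persists: only at its boundary does the sign of the
  derivative matter.
\<close>

lemma eventually_at_right_nonneg:
  fixes g :: "real \<Rightarrow> real"
  assumes D: "(g has_real_derivative D) (at t)" and "g t \<ge> 0" and "g t = 0 \<Longrightarrow> D > 0"
  shows "eventually (\<lambda>s. 0 \<le> g s) (at_right t)"
proof (cases "g t = 0")
  case True
  then obtain d where d: "d > 0" "\<And>h. 0 < h \<Longrightarrow> h < d \<Longrightarrow> g t < g (t + h)"
    using DERIV_pos_inc_right[OF D] assms(3) by blast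
  then have "0 \<le> g s" if "t < s" "s < t + d" for s
    using d(2)[of "s - t"] that True by simp
  then show ?thesis
    using d(1) by (auto simp: eventually_at_right_field intro!: exI[of _ "t + d"])
next
  case False
  then have "g t > 0" using assms(2) by simp
  moreover have "(g \<longlongrightarrow> g t) (at_right t)"
    using DERIV_isCont[OF D] by (simp add: isCont_def filterlim_at_split)
  ultimately have "eventually (\<lambda>s. g s > 0) (at_right t)"
    by (simp add: order_tendstoD)
  then show ?thesis
    by (rule eventually_mono) simp
qed

text \<open>
  An orbit that starts in S stays there, so its x-coordinate increases strictly and cannot
  return to its initial value.
\<close>

lemma rightward_trap_not_all_periodic:
  assumes cl: "closed S" and start: "(x0, y0) \<in> S"
    and invariant: "\<And>X Y t. newton_solution F X Y \<Longrightarrow> (X t, Y t) \<in> S \<Longrightarrow>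
       eventually (\<lambda>s. (X s, Y s) \<in> S) (at_right t)"
    and rightward: "\<And>x y. (x, y) \<in> S \<Longrightarrow> y > 0"
  shows "\<not> all_periodic F"
proof
  assume "all_periodic F"
  moreover have "(x0, y0) \<in> UNIV - {(0, 0)}"
    using rightward[OF start] by simp
  ultimately obtain X Y T where sol: "newton_solution F X Y" and init: "X 0 = x0" "Y 0 = y0"
    and "T > 0" and per: "\<And>t. X (t + T) = X t"
    unfolding all_periodic_def filled_with_periodic_orbits_def by (metis periodic_orbit_newtonE)
  have DX: "(X has_real_derivative Y t) (at t)" and DY: "(Y has_real_derivative F (X t) (Y t)) (at t)" for t
    using sol by (auto simp: newton_solution_def)
  have "isCont X t" "isCont Y t" for t
    using DX[of t] DY[of t] by (blast intro: DERIV_isCont)+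
  then have "continuous_on UNIV (\<lambda>t. (X t, Y t))"
    by (intro continuous_on_Pair continuous_at_imp_continuous_on) auto
  then have "closed ((\<lambda>t. (X t, Y t)) -` S)"
    using cl by (rule closed_vimage[rotated])
  then have cl': "closed {t. (X t, Y t) \<in> S}"
    by (simp add: vimage_def)
  have "(X t, Y t) \<in> S" if "t \<ge> 0" for t
  proof (rule real_continuation_induct[OF cl' _ _ that])
    show "(X 0, Y 0) \<in> S"
      using start init by simp
  qed (rule invariant[OF sol])
  then have "Y t > 0" if "t \<ge> 0" for t
    using rightward[of "X t" "Y t"] that by simp
  then have "X 0 < X T"
    using DX by (intro DERIV_pos_imp_increasing[OF \<open>T > 0\<close>]) blast
  then show False
    using per[of 0] by simp
qed

text \<open>
  Along an orbit that moves in the strip, dx/dy = y / F x y \<le> 1 / (c y^2), so x + 1/(c y) does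
  not increase. With the constant 1/c doubled to K, the quantity x + K/y decreases strictly, and
  x + K/y \<le> r keeps the orbit in the strip although y grows without bound.
\<close>

lemma cubic_force_not_all_periodic:
  assumes "c > 0" "l < r"
    and force: "\<And>x y. l \<le> x \<Longrightarrow> x \<le> r \<Longrightarrow> Y0 \<le> y \<Longrightarrow> F x y \<ge> c * y ^ 3"
  shows "\<not> all_periodic F"
proof -
  define K where "K = 2 / c"
  define Y1 where "Y1 = Max {1, Y0, K / (r - l)}"
  have K: "K > 0" "K * c = 2"
    using \<open>c > 0\<close> by (auto simp: K_def)
  have Y1: "Y1 \<ge> 1" "Y1 \<ge> Y0" "K \<le> (r - l) * Y1"
  proof -
    show "Y1 \<ge> 1" "Y1 \<ge> Y0"
      by (auto simp: Y1_def)
    have "K / (r - l) \<le> Y1"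
      by (auto simp: Y1_def)
    then show "K \<le> (r - l) * Y1"
      using \<open>l < r\<close> by (simp add: field_simps)
  qed
  \<comment> \<open>The last condition is x + K/y \<le> r, multiplied by y to make it polynomial.\<close>
  define S where "S = {(x, y). 0 \<le> x - l \<and> 0 \<le> y - Y1 \<and> 0 \<le> (r - x) * y - K}"
  show ?thesis
  proof (rule rightward_trap_not_all_periodic)
    show "closed S"
      unfolding S_def case_prod_beta
      by (intro closed_Collect_conj closed_Collect_le continuous_intros)
    show "(l, Y1) \<in> S"
      using Y1 by (simp add: S_def)
    show "y > 0" if "(x, y) \<in> S" for x y
      using that Y1 by (simp add: S_def)
  next
    fix X Y t assume sol: "newton_solution F X Y" and inS: "(X t, Y t) \<in> S"
    have DX: "(X has_real_derivative Y t) (at t)" and DY: "(Y has_real_derivative F (X t) (Y t)) (at t)"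
      using sol by (auto simp: newton_solution_def)
    have y: "Y t \<ge> Y1" "Y t > 0" and x: "l \<le> X t" and xy: "K \<le> (r - X t) * Y t"
      using inS Y1 by (auto simp: S_def)
    then have "0 < (r - X t) * Y t"
      using K by linarith
    then have xr: "0 < r - X t"
      using y by (simp add: zero_less_mult_iff)
    have F: "F (X t) (Y t) \<ge> c * Y t ^ 3"
      using force x xr y Y1 by simp
    have "c * Y t ^ 3 > 0"
      using \<open>c > 0\<close> y by simp
    have "eventually (\<lambda>s. 0 \<le> X s - l) (at_right t)"
      by (rule eventually_at_right_nonneg[where D = "Y t"])
        (use x y in \<open>auto intro!: derivative_eq_intros DX\<close>)
    moreover have "eventually (\<lambda>s. 0 \<le> Y s - Y1) (at_right t)"
      by (rule eventually_at_right_nonneg[where D = "F (X t) (Y t)"])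
        (use y F \<open>c * Y t ^ 3 > 0\<close> in \<open>auto intro!: derivative_eq_intros DY\<close>)
    moreover have "eventually (\<lambda>s. 0 \<le> (r - X s) * Y s - K) (at_right t)"
    proof (rule eventually_at_right_nonneg[where D = "(r - X t) * F (X t) (Y t) - Y t * Y t"])
      show "((\<lambda>s. (r - X s) * Y s - K) has_real_derivative
          (r - X t) * F (X t) (Y t) - Y t * Y t) (at t)"
        by (auto intro!: derivative_eq_intros DX DY)
      show "0 \<le> (r - X t) * Y t - K"
        using xy by simp
      assume bd: "(r - X t) * Y t - K = 0"
      have "2 * (Y t * Y t) = c * ((r - X t) * Y t) * Y t ^ 2"
        using bd K by (simp add: power2_eq_square algebra_simps)
      also have "\<dots> = (r - X t) * (c * Y t ^ 3)"
        by (simp add: power2_eq_square power3_eq_cube)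
      also have "\<dots> \<le> (r - X t) * F (X t) (Y t)"
        using F xr by (intro mult_left_mono) auto
      finally show "0 < (r - X t) * F (X t) (Y t) - Y t * Y t"
        using y mult_pos_pos[of "Y t" "Y t"] by linarith
    qed
    ultimately show "eventually (\<lambda>s. (X s, Y s) \<in> S) (at_right t)"
      by (simp add: S_def eventually_conj_iff)
  qed
qed

section \<open>Quadrature and inverse functions on the line\<close>

lemma antiderivative_on_line:
  fixes f :: "real \<Rightarrow> real"
  assumes "\<And>x. isCont f x"
  obtains G where "\<And>x. (G has_real_derivative f x) (at x)"
proof -
  have "\<exists>G. \<forall>x. -\<infinity> < ereal x \<longrightarrow> ereal x < \<infinity> \<longrightarrow> (G has_vector_derivative f x) (at x)"
    by (rule einterval_antiderivative) (use assms in auto)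
  then show thesis
    using that by (auto simp: has_real_derivative_iff_has_vector_derivative)
qed

lemma increasing_diffeo_inverse:
  fixes u u' :: "real \<Rightarrow> real"
  assumes D: "\<And>x. (u has_real_derivative u' x) (at x)" and pos: "\<And>x. 0 < u' x"
    and below: "\<And>s. \<exists>x. u x \<le> s" and above: "\<And>s. \<exists>x. s \<le> u x"
  obtains v where "\<And>x. v (u x) = x" "\<And>s. u (v s) = s"
    "\<And>s. (v has_real_derivative inverse (u' (v s))) (at s)"
proof -
  have mono: "u x < u y" if "x < y" for x y
    using D pos by (intro DERIV_pos_imp_increasing[OF that]) blast
  have inj: "inj u"
    by (rule injI) (metis mono linorder_neq_iff order_less_irrefl)
  have cont: "isCont u x" for x
    using D by (rule DERIV_isCont)
  have "\<exists>x. u x = s" for s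
  proof -
    obtain a b where ab: "u a \<le> s" "s \<le> u b"
      using below above by blast
    then have "a \<le> b"
      using mono[of b a] by linarith
    then show ?thesis
      using IVT[of u a s b] ab cont by blast
  qed
  then have surj: "surj u"
    by (metis surjI)
  define v where "v = inv u"
  have vu: "v (u x) = x" and uv: "u (v s) = s" for x s
    using inj surj by (auto simp: v_def surj_f_inv_f)
  have "isCont v (u (v s))" for s
    by (rule isCont_inverse_function[where d = 1]) (auto simp: vu cont)
  then have "isCont v s" for s
    by (simp add: uv)
  then have "(v has_real_derivative inverse (u' (v s))) (at s)" for s
    using D pos[of "v s"] uv
    by (intro DERIV_inverse_function[where a = "s - 1" and b = "s + 1" and f = u]) auto
  with that vu uv show thesis by blast
qed

text \<open>
  The time needed to reach the phase \<phi> is the integral of 1/\<Omega> from \<theta>0 to \<phi>, and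
  \<theta> is its inverse function. As \<Omega> has period 2 pi, every turn takes the same time T.
\<close>

lemma phase_equation_solution:
  fixes \<Omega> :: "real \<Rightarrow> real"
  assumes cont: "\<And>\<phi>. isCont \<Omega> \<phi>" and pos: "\<And>\<phi>. 0 < \<Omega> \<phi>"
    and per: "\<And>\<phi>. \<Omega> (\<phi> + 2 * pi) = \<Omega> \<phi>"
  obtains \<theta> T where "\<And>t. (\<theta> has_real_derivative \<Omega> (\<theta> t)) (at t)" "\<theta> 0 = \<theta>0"
    "T > 0" "\<And>t. \<theta> (t + T) = \<theta> t + 2 * pi"
proof -
  obtain \<sigma> where D\<sigma>: "\<And>\<phi>. (\<sigma> has_real_derivative inverse (\<Omega> \<phi>)) (at \<phi>)"
    using antiderivative_on_line[of "\<lambda>\<phi>. inverse (\<Omega> \<phi>)"] cont pos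
    by (metis continuous_at_within_inverse less_irrefl)
  define \<tau> where "\<tau> = (\<lambda>\<phi>. \<sigma> \<phi> - \<sigma> \<theta>0)"
  have D: "(\<tau> has_real_derivative inverse (\<Omega> \<phi>)) (at \<phi>)" for \<phi>
    unfolding \<tau>_def by (auto intro!: derivative_eq_intros D\<sigma>)
  define T where "T = \<tau> (\<theta>0 + 2 * pi)"
  have shift: "\<tau> (\<phi> + 2 * pi) = \<tau> \<phi> + T" for \<phi>
  proof -
    have "((\<lambda>\<phi>. \<tau> (\<phi> + 2 * pi) - \<tau> \<phi>) has_real_derivative 0) (at \<phi>)" for \<phi>
    proof -
      have "((\<lambda>\<phi>. \<tau> (\<phi> + 2 * pi)) has_real_derivative inverse (\<Omega> \<phi>)) (at \<phi>)"
        using D[of "\<phi> + 2 * pi"] by (simp add: DERIV_shift per)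
      from DERIV_diff[OF this D] show ?thesis by simp
    qed
    then have "\<tau> (\<phi> + 2 * pi) - \<tau> \<phi> = \<tau> (\<theta>0 + 2 * pi) - \<tau> \<theta>0"
      using DERIV_isconst_all[of "\<lambda>\<phi>. \<tau> (\<phi> + 2 * pi) - \<tau> \<phi>"] by blast
    then show ?thesis
      by (simp add: T_def \<tau>_def)
  qed
  have T: "T > 0"
  proof -
    have "\<tau> \<theta>0 < \<tau> (\<theta>0 + 2 * pi)"
      by (rule DERIV_pos_imp_increasing) (use D pos in \<open>auto intro!: exI\<close>)
    then show ?thesis by (simp add: T_def \<tau>_def)
  qed
  \<comment> \<open>Whole turns forwards and backwards show that \<tau> takes arbitrarily large and small values.\<close>
  have up: "\<tau> (\<theta>0 + 2 * pi * real n) = n * T" for n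
  proof (induction n)
    case (Suc n)
    then show ?case using shift[of "\<theta>0 + 2 * pi * real n"] by (simp add: algebra_simps)
  qed (simp add: \<tau>_def)
  have down: "\<tau> (\<theta>0 - 2 * pi * real n) = - (n * T)" for n
  proof (induction n)
    case (Suc n)
    then show ?case using shift[of "\<theta>0 - 2 * pi * real (Suc n)"] by (simp add: algebra_simps)
  qed (simp add: \<tau>_def)
  have "\<exists>\<phi>. s \<le> \<tau> \<phi>" for s
    using up reals_Archimedean3[OF T] by (metis less_imp_le)
  moreover have "\<exists>\<phi>. \<tau> \<phi> \<le> s" for s
  proof -
    obtain n :: nat where "- s < n * T"
      using reals_Archimedean3[OF T] by blast
    then have "\<tau> (\<theta>0 - 2 * pi * real n) \<le> s"
      using down[of n] by simp
    then show ?thesis by blast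
  qed
  moreover have "0 < inverse (\<Omega> \<phi>)" for \<phi>
    using pos by simp
  ultimately obtain \<theta> where inv: "\<And>\<phi>. \<theta> (\<tau> \<phi>) = \<phi>" "\<And>s. \<tau> (\<theta> s) = s"
    and D\<theta>: "\<And>s. (\<theta> has_real_derivative inverse (inverse (\<Omega> (\<theta> s)))) (at s)"
    using increasing_diffeo_inverse[of \<tau> "\<lambda>\<phi>. inverse (\<Omega> \<phi>)", OF D] by metis
  show thesis
  proof (rule that[OF _ _ T])
    show "(\<theta> has_real_derivative \<Omega> (\<theta> t)) (at t)" for t
      using D\<theta> by simp
    have "\<tau> \<theta>0 = 0" by (simp add: \<tau>_def)
    then show "\<theta> 0 = \<theta>0" using inv(1) by metis
    show "\<theta> (t + T) = \<theta> t + 2 * pi" for t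
      using inv shift by metis
  qed
qed

section \<open>The terms of degree at least three in the velocity\<close>

definition quintic_force ::
    "real \<Rightarrow> real \<Rightarrow> real \<Rightarrow> real \<Rightarrow> real \<Rightarrow> real \<Rightarrow> real \<Rightarrow> real \<Rightarrow> real" where
  "quintic_force a05 a14 a23 a32 a41 a50 x y =
     - x + a05 * y ^ 5 + a14 * x * y ^ 4 + a23 * x ^ 2 * y ^ 3
       + a32 * x ^ 3 * y ^ 2 + a41 * x ^ 4 * y + a50 * x ^ 5"

lemma quintic_field_eq_newton:
  "quintic_field a05 a14 a23 a32 a41 a50 = newton_field (quintic_force a05 a14 a23 a32 a41 a50)"
  by (simp add: quintic_field_def newton_field_def quintic_force_def)

lemma quintic_force_reverse:
  "(\<lambda>x y. quintic_force a05 a14 a23 a32 a41 a50 x (- y)) =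
     quintic_force (- a05) a14 (- a23) a32 (- a41) a50"
  by (intro ext) (simp add: quintic_force_def)

lemma monomial_lower_bound:
  fixes a x y :: real
  assumes "\<bar>x\<bar> \<le> 1" "1 \<le> y" "j \<le> n"
  shows "- (\<bar>a\<bar> * y ^ n) \<le> a * x ^ i * y ^ j"
proof -
  have "\<bar>x ^ i\<bar> \<le> 1"
    using assms(1) by (simp add: power_abs power_le_one)
  moreover have "\<bar>y ^ j\<bar> \<le> y ^ n"
    using assms by (simp add: power_abs power_increasing)
  ultimately have "\<bar>x ^ i\<bar> * \<bar>y ^ j\<bar> \<le> 1 * y ^ n"
    by (intro mult_mono) auto
  then have "\<bar>a\<bar> * (\<bar>x ^ i\<bar> * \<bar>y ^ j\<bar>) \<le> \<bar>a\<bar> * y ^ n"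
    by (intro mult_left_mono) auto
  then have "\<bar>a * x ^ i * y ^ j\<bar> \<le> \<bar>a\<bar> * y ^ n"
    by (simp add: abs_mult mult.assoc)
  then show ?thesis by linarith
qed

text \<open>
  Here and in the next two lemmas, if n + 1 is the leading degree in y, the other terms together
  are at least -M y^n for \<bar>x\<bar> \<le> 1 and y \<ge> 1, so the leading term wins for large y.
\<close>

lemma coefficient_y5_nonpos:
  assumes "all_periodic (quintic_force a05 a14 a23 a32 a41 a50)"
  shows "a05 \<le> 0"
proof (rule ccontr)
  assume "\<not> a05 \<le> 0"
  then have a: "a05 > 0" by simp
  define M where "M = 1 + \<bar>a14\<bar> + \<bar>a23\<bar> + \<bar>a32\<bar> + \<bar>a41\<bar> + \<bar>a50\<bar>"
  have "\<not> all_periodic (quintic_force a05 a14 a23 a32 a41 a50)"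
  proof (rule cubic_force_not_all_periodic[where c = 1 and l = 0 and r = 1
        and ?Y0.0 = "max 1 ((M + 1) / a05)"])
    fix x y :: real
    assume x: "0 \<le> x" "x \<le> 1" and "max 1 ((M + 1) / a05) \<le> y"
    then have y: "1 \<le> y" and "(M + 1) / a05 \<le> y" by auto
    then have big: "1 \<le> a05 * y - M"
      using a by (simp add: field_simps)
    have x': "\<bar>x\<bar> \<le> 1" using x by simp
    note b = monomial_lower_bound[OF x' y, where n = 4]
    have "1 * y ^ 3 \<le> y ^ 4"
      using y power_increasing[of 3 4 y] by simp
    also have "\<dots> \<le> (a05 * y - M) * y ^ 4"
      using big y mult_right_mono[of 1 "a05 * y - M" "y ^ 4"] by simp
    also have "\<dots> = a05 * y ^ 5 - M * y ^ 4"
      by (simp add: algebra_simps eval_nat_numeral)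
    also have "\<dots> \<le> quintic_force a05 a14 a23 a32 a41 a50 x y"
      using b[of 0 "-1" 1] b[of 4 a14 1] b[of 3 a23 2] b[of 2 a32 3] b[of 1 a41 4] b[of 0 a50 5]
      by (simp add: quintic_force_def M_def algebra_simps)
    finally show "1 * y ^ 3 \<le> quintic_force a05 a14 a23 a32 a41 a50 x y" .
  qed auto
  then show False using assms by simp
qed

lemma coefficient_xy4_zero:
  assumes "all_periodic (quintic_force 0 a14 a23 a32 a41 a50)"
  shows "a14 = 0"
proof (rule ccontr)
  assume a: "a14 \<noteq> 0"
  \<comment> \<open>The strip lies on the side of the y-axis where a14 x is positive.\<close>
  define l where "l = (if a14 > 0 then 1/2 else - 1 :: real)"
  define M where "M = 1 + \<bar>a23\<bar> + \<bar>a32\<bar> + \<bar>a41\<bar> + \<bar>a50\<bar>"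
  have "\<not> all_periodic (quintic_force 0 a14 a23 a32 a41 a50)"
  proof (rule cubic_force_not_all_periodic[where c = 1 and l = l and r = "l + 1/2"
        and ?Y0.0 = "max 1 ((M + 1) / (\<bar>a14\<bar> / 2))"])
    fix x y :: real
    assume x: "l \<le> x" "x \<le> l + 1/2" and "max 1 ((M + 1) / (\<bar>a14\<bar> / 2)) \<le> y"
    then have y: "1 \<le> y" and "(M + 1) / (\<bar>a14\<bar> / 2) \<le> y" by auto
    then have big: "1 \<le> \<bar>a14\<bar> / 2 * y - M"
      using a by (simp add: field_simps)
    have x': "\<bar>x\<bar> \<le> 1" using x by (simp add: l_def split: if_splits)
    have "\<bar>x\<bar> \<ge> 1/2" and "a14 * x = \<bar>a14\<bar> * \<bar>x\<bar>"
      using x a by (auto simp: l_def abs_mult[symmetric] mult_nonpos_nonpos split: if_splits)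
    then have lead: "\<bar>a14\<bar> / 2 \<le> a14 * x"
      using mult_left_mono[of "1/2" "\<bar>x\<bar>" "\<bar>a14\<bar>"] by simp
    note b = monomial_lower_bound[OF x' y, where n = 3]
    have "1 * y ^ 3 \<le> (\<bar>a14\<bar> / 2 * y - M) * y ^ 3"
      using big y by (intro mult_right_mono) auto
    also have "\<dots> = \<bar>a14\<bar> / 2 * y ^ 4 - M * y ^ 3"
      by (simp add: algebra_simps eval_nat_numeral)
    also have "\<dots> \<le> a14 * x * y ^ 4 - M * y ^ 3"
      using lead y by (intro diff_right_mono mult_right_mono) auto
    also have "\<dots> \<le> quintic_force 0 a14 a23 a32 a41 a50 x y"
      using b[of 0 "-1" 1] b[of 3 a23 2] b[of 2 a32 3] b[of 1 a41 4] b[of 0 a50 5] y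
      by (simp add: quintic_force_def M_def algebra_simps)
    finally show "1 * y ^ 3 \<le> quintic_force 0 a14 a23 a32 a41 a50 x y" .
  qed auto
  then show False using assms by simp
qed

lemma coefficient_x2y3_nonpos:
  assumes "all_periodic (quintic_force 0 0 a23 a32 a41 a50)"
  shows "a23 \<le> 0"
proof (rule ccontr)
  assume "\<not> a23 \<le> 0"
  then have a: "a23 > 0" by simp
  define M where "M = 1 + \<bar>a32\<bar> + \<bar>a41\<bar> + \<bar>a50\<bar>"
  have "\<not> all_periodic (quintic_force 0 0 a23 a32 a41 a50)"
  proof (rule cubic_force_not_all_periodic[where c = "a23 / 8" and l = "1/2" and r = 1
        and ?Y0.0 = "max 1 (M / (a23 / 8))"])
    fix x y :: real
    assume x: "1/2 \<le> x" "x \<le> 1" and "max 1 (M / (a23 / 8)) \<le> y"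
    then have y: "1 \<le> y" and "M / (a23 / 8) \<le> y" by auto
    then have big: "0 \<le> a23 / 8 * y - M"
      using a by (simp add: field_simps)
    have x': "\<bar>x\<bar> \<le> 1" using x by simp
    have "(1/2) ^ 2 \<le> x ^ 2"
      using x by (intro power_mono) auto
    then have lead: "a23 / 4 \<le> a23 * x ^ 2"
      using a by (simp add: power2_eq_square)
    note b = monomial_lower_bound[OF x' y, where n = 2]
    have "a23 / 8 * y ^ 3 \<le> a23 / 8 * y ^ 3 + (a23 / 8 * y - M) * y ^ 2"
      using big y by simp
    also have "\<dots> = a23 / 4 * y ^ 3 - M * y ^ 2"
      by (simp add: algebra_simps eval_nat_numeral)
    also have "\<dots> \<le> a23 * x ^ 2 * y ^ 3 - M * y ^ 2"
      using lead y by (intro diff_right_mono mult_right_mono) auto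
    also have "\<dots> \<le> quintic_force 0 0 a23 a32 a41 a50 x y"
      using b[of 0 "-1" 1] b[of 2 a32 3] b[of 1 a41 4] b[of 0 a50 5] y
      by (simp add: quintic_force_def M_def algebra_simps)
    finally show "a23 / 8 * y ^ 3 \<le> quintic_force 0 0 a23 a32 a41 a50 x y" .
  qed (use a in auto)
  then show False using assms by simp
qed

lemma all_periodic_higher_y_powers_vanish:
  assumes "all_periodic (quintic_force a05 a14 a23 a32 a41 a50)"
  shows "a05 = 0 \<and> a14 = 0 \<and> a23 = 0"
proof -
  note rev = all_periodic_reverse[of "quintic_force _ _ _ _ _ _", unfolded quintic_force_reverse]
  have 5: "a05 = 0"
    using coefficient_y5_nonpos[OF assms] coefficient_y5_nonpos[OF rev[OF assms]] by simp
  then have 4: "a14 = 0"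
    using coefficient_xy4_zero assms by blast
  have *: "all_periodic (quintic_force 0 0 a23 a32 a41 a50)"
    using assms 4 5 by simp
  have "a23 = 0"
    using coefficient_x2y3_nonpos[OF *] coefficient_x2y3_nonpos[of "- a23" a32 "- a41" a50] rev[OF *]
    by simp
  with 4 5 show ?thesis by simp
qed

section \<open>The signs of the remaining coefficients\<close>

lemma quintic_force_xy2:
  "quintic_force 0 0 0 a32 a41 a50 x y = - x + a32 * x ^ 3 * y ^ 2 + a41 * x ^ 4 * y + a50 * x ^ 5"
  by (simp add: quintic_force_def)

lemma periodic_mono_constant:
  fixes H :: "real \<Rightarrow> real"
  assumes D: "\<And>t. (H has_real_derivative H' t) (at t)" and pos: "\<And>t. 0 \<le> H' t"
    and "T > 0" and per: "\<And>t. H (t + T) = H t"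
  shows "H' t = 0"
proof -
  have mono: "H s \<le> H t" if "s \<le> t" for s t
    using D pos by (intro DERIV_nonneg_imp_nondecreasing[OF that]) blast
  have *: "H s = H t" if "t \<le> s" "s \<le> t + T" for s t
    using mono[OF that(1)] mono[OF that(2)] per[of t] by simp
  have "eventually (\<lambda>s. s \<in> {t - T<..<t + T}) (nhds t)"
    using \<open>T > 0\<close> by (intro eventually_nhds_in_open) auto
  then have "eventually (\<lambda>s. H s = H t) (nhds t)"
  proof (rule eventually_mono)
    fix s assume "s \<in> {t - T<..<t + T}"
    then show "H s = H t"
      using *[of t s] *[of s t] by (cases "t \<le> s") auto
  qed
  then have "(H has_real_derivative 0) (at t)"
    by (subst DERIV_cong_ev[OF refl _ refl, where g = "\<lambda>_. H t"]) auto
  then show ?thesis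
    using D DERIV_unique by blast
qed

text \<open>
  For a41 = 0 the orbits satisfy d(y^2)/dx = 2 (-x + a32 x^3 y^2 + a50 x^5), and the integrating
  factor exp(-a32 x^4/2) gives a first integral. The damping term a41 x^4 y changes that integral at
  a rate of the sign of a41, and a monotone periodic function is constant; so the orbit would have
  x y = 0 throughout, which makes x^2 constant.
\<close>

lemma coefficient_x4y_zero:
  assumes per: "periodic_orbit (newton_field (quintic_force 0 0 0 a32 a41 a50)) C"
  shows "a41 = 0"
proof (rule ccontr)
  assume a41: "a41 \<noteq> 0"
  have "C \<noteq> {}"
    using per by (auto simp: periodic_orbit_def)
  then obtain x0 y0 where "(x0, y0) \<in> C"
    by auto
  then obtain X Y T where sol: "newton_solution (quintic_force 0 0 0 a32 a41 a50) X Y"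
    and T: "T > 0" and per: "\<And>t. X (t + T) = X t" "\<And>t. Y (t + T) = Y t"
    and nc: "\<not> X constant_on UNIV"
    by (metis periodic_orbit_newtonE per)
  have DX: "(X has_real_derivative Y t) (at t)"
    and DY: "(Y has_real_derivative
      (- X t + a32 * X t ^ 3 * Y t ^ 2 + a41 * X t ^ 4 * Y t + a50 * X t ^ 5)) (at t)" for t
    using sol by (auto simp: newton_solution_def quintic_force_xy2)
  define e where "e = (\<lambda>x::real. exp (- a32 * x ^ 4 / 2))"
  obtain G where DG: "\<And>x. (G has_real_derivative (x - a50 * x ^ 5) * e x) (at x)"
    by (rule antiderivative_on_line[of "\<lambda>x. (x - a50 * x ^ 5) * e x"])
      (auto simp: e_def)
  have De: "(e has_real_derivative (- 2 * a32 * x ^ 3) * e x) (at x)" for x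
    unfolding e_def by (auto intro!: derivative_eq_intros)
  \<comment> \<open>The integral is multiplied by a41 so that its derivative is nonnegative for either sign of a41.\<close>
  define H where "H = (\<lambda>t. a41 * (Y t ^ 2 / 2 * e (X t) + G (X t)))"
  have DH: "(H has_real_derivative (a41 * X t ^ 2 * Y t) ^ 2 * e (X t)) (at t)" for t
  proof -
    note D1 = DERIV_chain2[OF De DX] and D2 = DERIV_chain2[OF DG DX]
    show ?thesis
      unfolding H_def
      by (auto intro!: derivative_eq_intros DX DY D1 D2)
        (simp add: field_simps eval_nat_numeral)
  qed
  have H'0: "(a41 * X t ^ 2 * Y t) ^ 2 * e (X t) = 0" for t
    by (rule periodic_mono_constant[OF DH _ T]) (auto simp: e_def H_def per)
  have XY: "X t * Y t = 0" for t
    using H'0[of t] a41 by (simp add: e_def)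
  have "((\<lambda>t. X t ^ 2) has_real_derivative 0) (at t)" for t
    using XY[of t] by (auto intro!: derivative_eq_intros DX)
  then have sq: "X t ^ 2 = X 0 ^ 2" for t
    using DERIV_isconst_all by blast
  have "Y t = 0" for t
  proof (cases "X 0 = 0")
    case True
    then have "X = (\<lambda>t. 0)" using sq by auto
    then show ?thesis using DX[of t] DERIV_unique[of X "Y t" t 0] by auto
  next
    case False
    then show ?thesis using sq[of t] XY[of t] by auto
  qed
  then have "X t = X 0" for t
    using DX DERIV_isconst_all[of X] by simp
  then show False
    using nc by (auto simp: constant_on_def)
qed

text \<open>
  On the ray y = k x the force is (a32 k^2 + a50) x^5 - x, and k is chosen so that the leading
  coefficient is at least 1. Far from the origin the slope dy/dx along the ray then exceeds k, so
  the sector above the ray cannot be left.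
\<close>

lemma coefficient_x3y2_nonpos:
  assumes per: "all_periodic (quintic_force 0 0 0 a32 0 a50)"
  shows "a32 \<le> 0"
proof (rule ccontr)
  assume "\<not> a32 \<le> 0"
  then have a: "a32 > 0" by simp
  define k where "k = sqrt ((\<bar>a50\<bar> + 1) / a32)"
  \<comment> \<open>The ray is crossed inwards where x^4 > 1 + k^2, and x \<ge> k^2 + 2 ensures this.\<close>
  define x1 where "x1 = k ^ 2 + 2"
  have k: "k > 0" "a32 * k ^ 2 = \<bar>a50\<bar> + 1"
    using a by (auto simp: k_def)
  have x1: "x1 \<ge> 1" by (simp add: x1_def)
  define S where "S = {(x, y). 0 \<le> x - x1 \<and> 0 \<le> y - k * x}"
  have "\<not> all_periodic (quintic_force 0 0 0 a32 0 a50)"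
  proof (rule rightward_trap_not_all_periodic)
    show "closed S"
      unfolding S_def case_prod_beta
      by (intro closed_Collect_conj closed_Collect_le continuous_intros)
    show "(x1, k * x1) \<in> S"
      by (simp add: S_def)
    show pos: "y > 0" if "(x, y) \<in> S" for x y
    proof -
      have "0 < k * x" using that k x1 by (auto simp: S_def)
      then show ?thesis using that by (auto simp: S_def)
    qed
    fix X Y t assume sol: "newton_solution (quintic_force 0 0 0 a32 0 a50) X Y"
      and inS: "(X t, Y t) \<in> S"
    have DX: "(X has_real_derivative Y t) (at t)"
      and DY: "(Y has_real_derivative (- X t + a32 * X t ^ 3 * Y t ^ 2 + a50 * X t ^ 5)) (at t)"
      using sol by (auto simp: newton_solution_def quintic_force_xy2)
    have x: "X t \<ge> x1" "X t \<ge> 1" and y: "Y t > 0" "k * X t \<le> Y t"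
      using inS pos[OF inS] x1 by (auto simp: S_def)
    have "eventually (\<lambda>s. 0 \<le> X s - x1) (at_right t)"
      by (rule eventually_at_right_nonneg[where D = "Y t"])
        (use x y in \<open>auto intro!: derivative_eq_intros DX\<close>)
    moreover have "eventually (\<lambda>s. 0 \<le> Y s - k * X s) (at_right t)"
    proof (rule eventually_at_right_nonneg)
      show "((\<lambda>s. Y s - k * X s) has_real_derivative
          - X t + a32 * X t ^ 3 * Y t ^ 2 + a50 * X t ^ 5 - k * Y t) (at t)"
        by (auto intro!: derivative_eq_intros DX DY)
      assume "Y t - k * X t = 0"
      then have Y: "Y t = k * X t" by simp
      have "X t ^ 1 \<le> X t ^ 4"
        using x by (intro power_increasing) auto
      then have "1 + k ^ 2 < X t ^ 4"
        using x by (simp add: x1_def)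
      also have "\<dots> = (\<bar>a50\<bar> + 1) * X t ^ 4 - \<bar>a50\<bar> * X t ^ 4"
        by (simp add: algebra_simps)
      also have "\<dots> \<le> a32 * k ^ 2 * X t ^ 4 + a50 * X t ^ 4"
        using mult_right_mono[of "- \<bar>a50\<bar>" a50 "X t ^ 4"] k by simp
      finally have "0 < X t * (a32 * k ^ 2 * X t ^ 4 + a50 * X t ^ 4 - 1 - k ^ 2)"
        using x by simp
      also have "\<dots> = - X t + a32 * X t ^ 3 * Y t ^ 2 + a50 * X t ^ 5 - k * Y t"
        by (simp add: Y algebra_simps eval_nat_numeral)
      finally show "0 < - X t + a32 * X t ^ 3 * Y t ^ 2 + a50 * X t ^ 5 - k * Y t" .
    qed (use y in auto)
    ultimately show "eventually (\<lambda>s. (X s, Y s) \<in> S) (at_right t)"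
      by (simp add: S_def eventually_conj_iff)
  qed
  then show False
    using per by simp
qed

text \<open>
  On the line y = 1 the force is a50 x^5 + a32 x^3 - x, positive for large x; the orbits that cross
  this line far to the right are therefore trapped above it. This avoids discussing the equilibria
  that appear on the x-axis for a50 > 0.
\<close>

lemma coefficient_x5_nonpos:
  assumes per: "all_periodic (quintic_force 0 0 0 a32 0 a50)"
  shows "a50 \<le> 0"
proof (rule ccontr)
  assume "\<not> a50 \<le> 0"
  then have a: "a50 > 0" by simp
  define x1 where "x1 = 1 + (\<bar>a32\<bar> + 2) / a50"
  have "a50 * x1 = a50 + (\<bar>a32\<bar> + 2)"
    using a nonzero_mult_div_cancel_left[of a50 "\<bar>a32\<bar> + 2"]
    unfolding x1_def distrib_left[of a50 1] by simp
  then have x1: "x1 \<ge> 1" "a50 * x1 > \<bar>a32\<bar> + 1"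
    using a by (auto simp: x1_def)
  define S where "S = {(x::real, y::real). 0 \<le> x - x1 \<and> 0 \<le> y - 1}"
  have "\<not> all_periodic (quintic_force 0 0 0 a32 0 a50)"
  proof (rule rightward_trap_not_all_periodic)
    show "closed S"
      unfolding S_def case_prod_beta
      by (intro closed_Collect_conj closed_Collect_le continuous_intros)
    show "(x1, 1) \<in> S"
      by (simp add: S_def)
    show pos: "y > 0" if "(x, y) \<in> S" for x y
      using that by (auto simp: S_def)
    fix X Y t assume sol: "newton_solution (quintic_force 0 0 0 a32 0 a50) X Y"
      and inS: "(X t, Y t) \<in> S"
    have DX: "(X has_real_derivative Y t) (at t)"
      and DY: "(Y has_real_derivative (- X t + a32 * X t ^ 3 * Y t ^ 2 + a50 * X t ^ 5)) (at t)"
      using sol by (auto simp: newton_solution_def quintic_force_xy2)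
    have x: "X t \<ge> x1" "X t \<ge> 1" and y: "Y t \<ge> 1"
      using inS x1 by (auto simp: S_def)
    have "eventually (\<lambda>s. 0 \<le> X s - x1) (at_right t)"
      by (rule eventually_at_right_nonneg[where D = "Y t"])
        (use x y in \<open>auto intro!: derivative_eq_intros DX\<close>)
    moreover have "eventually (\<lambda>s. 0 \<le> Y s - 1) (at_right t)"
    proof (rule eventually_at_right_nonneg)
      show "((\<lambda>s. Y s - 1) has_real_derivative
          - X t + a32 * X t ^ 3 * Y t ^ 2 + a50 * X t ^ 5) (at t)"
        by (auto intro!: derivative_eq_intros DY)
      assume "Y t - 1 = 0"
      then have Y: "Y t = 1" by simp
      have "\<bar>a32\<bar> + 1 < a50 * X t"
        using x1 x a mult_left_mono[of x1 "X t" a50] by linarith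
      also have "\<dots> \<le> a50 * X t ^ 2"
        using a x power_increasing[of 1 2 "X t"] by simp
      finally have "0 < X t ^ 3 * (a50 * X t ^ 2 + a32 - 1)"
        using x by simp
      moreover have "X t ^ 1 \<le> X t ^ 3"
        using x by (intro power_increasing) auto
      ultimately show "0 < - X t + a32 * X t ^ 3 * Y t ^ 2 + a50 * X t ^ 5"
        by (simp add: Y algebra_simps eval_nat_numeral)
    qed (use y in auto)
    ultimately show "eventually (\<lambda>s. (X s, Y s) \<in> S) (at_right t)"
      by (simp add: S_def eventually_conj_iff)
  qed
  then show False
    using per by simp
qed

lemma all_periodic_quintic_coefficients:
  assumes per: "all_periodic (quintic_force a05 a14 a23 a32 a41 a50)"
  shows "a32 \<le> 0 \<and> a50 \<le> 0 \<and> a14 = 0 \<and> a41 = 0 \<and> a23 = 0 \<and> a05 = 0"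
proof -
  have z: "a05 = 0" "a14 = 0" "a23 = 0"
    using all_periodic_higher_y_powers_vanish[OF per] by auto
  have "(1, 0) \<in> UNIV - {(0 :: real, 0 :: real)}" by simp
  then have "a41 = 0"
    using per coefficient_x4y_zero
    unfolding z all_periodic_def filled_with_periodic_orbits_def by blast
  then show ?thesis
    using per z coefficient_x3y2_nonpos coefficient_x5_nonpos by simp
qed

section \<open>Periodic orbits from energy coordinates\<close>

text \<open>
  In the coordinates u x and w = y E x the equations become
  du/dt = \<omega> w and dw/dt = - \<omega> u, with
  the positive angular speed \<omega> = (du/dx) / E: the factor E is chosen so that the term
  - e x y^2 of the force cancels against the derivative of E. Hence (u, w) turns on a circle, and
  its angle solves an autonomous equation with 2 pi-periodic right-hand side.
\<close>

lemma all_periodic_of_energy_coordinates: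
  fixes u u' E e :: "real \<Rightarrow> real"
  assumes Du: "\<And>x. (u has_real_derivative u' x) (at x)" and u'pos: "\<And>x. 0 < u' x"
    and u'cont: "\<And>x. isCont u' x" and u0: "u 0 = 0"
    and below: "\<And>s. \<exists>x. u x \<le> s" and above: "\<And>s. \<exists>x. s \<le> u x"
    and DE: "\<And>x. (E has_real_derivative e x * E x) (at x)" and Epos: "\<And>x. 0 < E x"
    and F: "\<And>x y. F x y = - (u x * u' x / E x ^ 2) - e x * y ^ 2"
  shows "all_periodic F"
  unfolding all_periodic_def filled_with_periodic_orbits_def
proof
  fix q :: "real \<times> real" assume "q \<in> UNIV - {(0, 0)}"
  moreover obtain x0 y0 where q: "q = (x0, y0)" by force
  ultimately have nz: "x0 \<noteq> 0 \<or> y0 \<noteq> 0" by auto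
  obtain v where vu: "\<And>x. v (u x) = x" and uv: "\<And>s. u (v s) = s"
    and Dv: "\<And>s. (v has_real_derivative inverse (u' (v s))) (at s)"
    using increasing_diffeo_inverse[OF Du u'pos below above] by metis
  obtain r \<theta>0 where r: "y0 * E x0 = r * cos \<theta>0" "u x0 = r * sin \<theta>0"
    using polar_Ex by blast
  define \<omega> where "\<omega> = (\<lambda>x. u' x / E x)"
  define \<Omega> where "\<Omega> = (\<lambda>\<phi>. \<omega> (v (r * sin \<phi>)))"
  have \<omega>cont: "isCont \<omega> x" for x
    unfolding \<omega>_def using Epos[of x] DERIV_isCont[OF DE] u'cont
    by (intro isCont_divide) auto
  have "isCont \<Omega> \<phi>" for \<phi>
    unfolding \<Omega>_def
    by (rule isCont_o2[OF _ \<omega>cont], rule isCont_o2[OF _ DERIV_isCont[OF Dv]])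
      (auto intro!: continuous_intros)
  moreover have \<Omega>pos: "0 < \<Omega> \<phi>" for \<phi>
    using u'pos Epos by (simp add: \<Omega>_def \<omega>_def)
  moreover have "\<Omega> (\<phi> + 2 * pi) = \<Omega> \<phi>" for \<phi>
    by (simp add: \<Omega>_def)
  ultimately obtain \<theta> T where D\<theta>: "\<And>t. (\<theta> has_real_derivative \<Omega> (\<theta> t)) (at t)"
    and \<theta>0: "\<theta> 0 = \<theta>0" and T: "T > 0" and per: "\<And>t. \<theta> (t + T) = \<theta> t + 2 * pi"
    using phase_equation_solution[of \<Omega>] by metis
  \<comment> \<open>The angle is measured clockwise from the w-axis, because u grows where y > 0.\<close>
  define X where "X = (\<lambda>t. v (r * sin (\<theta> t)))"
  define Y where "Y = (\<lambda>t. r * cos (\<theta> t) / E (X t))"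
  have uX: "u (X t) = r * sin (\<theta> t)" for t
    by (simp add: X_def uv)
  have \<Omega>X: "\<Omega> (\<theta> t) = u' (X t) / E (X t)" for t
    by (simp add: \<Omega>_def \<omega>_def X_def)
  have DX: "(X has_real_derivative Y t) (at t)" for t
  proof -
    have "((\<lambda>t. r * sin (\<theta> t)) has_real_derivative r * (cos (\<theta> t) * \<Omega> (\<theta> t))) (at t)"
      by (auto intro!: derivative_eq_intros D\<theta>)
    from DERIV_chain2[OF Dv this]
    have "(X has_real_derivative inverse (u' (X t)) * (r * (cos (\<theta> t) * \<Omega> (\<theta> t)))) (at t)"
      by (simp add: X_def)
    moreover have "inverse (u' (X t)) * (r * (cos (\<theta> t) * \<Omega> (\<theta> t))) = Y t"
      using u'pos[of "X t"] by (simp add: \<Omega>X Y_def field_simps)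
    ultimately show ?thesis by simp
  qed
  have DY: "(Y has_real_derivative F (X t) (Y t)) (at t)" for t
  proof -
    have E: "E (X t) \<noteq> 0" using Epos[of "X t"] by simp
    have w: "r * cos (\<theta> t) = Y t * E (X t)"
      using E by (simp add: Y_def)
    have num: "((\<lambda>t. r * cos (\<theta> t)) has_real_derivative - (r * sin (\<theta> t)) * \<Omega> (\<theta> t)) (at t)"
      by (auto intro!: derivative_eq_intros D\<theta>)
    have "(Y has_real_derivative
        (- (r * sin (\<theta> t)) * \<Omega> (\<theta> t) * E (X t) - r * cos (\<theta> t) * (e (X t) * E (X t) * Y t))
          / (E (X t) * E (X t))) (at t)"
      unfolding Y_def[abs_def]
      using DERIV_divide[OF num DERIV_chain2[OF DE DX] E] by (simp add: Y_def)
    moreover have "(- (r * sin (\<theta> t)) * \<Omega> (\<theta> t) * E (X t)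
        - r * cos (\<theta> t) * (e (X t) * E (X t) * Y t)) / (E (X t) * E (X t)) = F (X t) (Y t)"
      unfolding w F \<Omega>X uX[symmetric] using E by (simp add: field_simps power2_eq_square)
    ultimately show ?thesis by simp
  qed
  have sol: "newton_solution F X Y"
    using DX DY by (simp add: newton_solution_def)
  have init: "X 0 = x0" "Y 0 = y0"
  proof -
    show "X 0 = x0" by (simp add: X_def \<theta>0 r(2)[symmetric] vu)
    then show "Y 0 = y0" using Epos[of x0] by (simp add: Y_def \<theta>0 r(1)[symmetric])
  qed
  have "\<not> X constant_on UNIV"
  proof
    assume "X constant_on UNIV"
    then obtain c where X: "X = (\<lambda>t. c)" by (auto simp: constant_on_def)
    have "Y t = 0" for t
      using DX[of t] DERIV_unique[of X "Y t" t 0] X by auto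
    then have Y: "Y = (\<lambda>t. 0)" by auto
    then have "F x0 0 = 0"
      using DY[of 0] DERIV_unique[of Y "F x0 0" 0 0] init by auto
    then have "u x0 = 0"
      using u'pos[of x0] Epos[of x0] by (simp add: F)
    then have "x0 = 0" using u0 vu by metis
    then show False using nz Y init by simp
  qed
  moreover have "X (t + T) = X t" "Y (t + T) = Y t" for t
    by (simp_all add: X_def Y_def per)
  ultimately show "\<exists>C. periodic_orbit (newton_field F) C \<and> q \<in> C"
    using newton_periodicI[OF sol T, of 0] init q by simp
qed

text \<open>
  Let K be the integral of \<kappa> from 0. The required u has u^2 = K (x^2); it must change sign
  with x, and it must be differentiable at 0, where the square root is not. Both hold for
  u x = x m x with m x = sqrt (K (x^2) / x^2), since K z / z extends continuously to z = 0 with the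
  value \<kappa> 0 = 1. The bound \<kappa> \<ge> 1 gives m \<ge> 1, so u maps onto the whole line.
\<close>

lemma square_root_coordinate:
  fixes \<kappa> :: "real \<Rightarrow> real"
  assumes cont: "\<And>z. isCont \<kappa> z" and ge: "\<And>z. 1 \<le> \<kappa> z" and \<kappa>0: "\<kappa> 0 = 1"
  obtains u u' where "\<And>x. (u has_real_derivative u' x) (at x)" "\<And>x. 0 < u' x"
    "\<And>x. isCont u' x" "u 0 = 0" "\<And>s. \<exists>x. u x \<le> s" "\<And>s. \<exists>x. s \<le> u x"
    "\<And>x. u x * u' x = x * \<kappa> (x ^ 2)"
proof -
  obtain K0 where DK0: "\<And>z. (K0 has_real_derivative \<kappa> z) (at z)"
    using antiderivative_on_line[OF cont] by blast
  define K where "K = (\<lambda>z. K0 z - K0 0)"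
  have DK: "(K has_real_derivative \<kappa> z) (at z)" for z
    unfolding K_def by (auto intro!: derivative_eq_intros DK0)
  \<comment> \<open>g is K z / z with the singularity at 0 removed.\<close>
  obtain g where g: "\<And>z. K z = g z * z" and g_cont0: "isCont g 0" and g0: "g 0 = 1"
    using DK[of 0] \<kappa>0 by (auto simp: CARAT_DERIV K_def)
  have g_eq: "g z = K z / z" if "z \<noteq> 0" for z
    using g[of z] that by simp
  have Dg: "(g has_real_derivative (\<kappa> z - g z) / z) (at z)" if "z \<noteq> 0" for z
  proof (rule has_field_derivative_transform_within_open[where S = "- {0}"])
    show "((\<lambda>z. K z / z) has_real_derivative (\<kappa> z - g z) / z) (at z)"
      using that by (auto intro!: derivative_eq_intros DK simp: g_eq field_simps)
  qed (use that g_eq in auto)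
  have g_cont: "isCont g z" for z
    using g_cont0 DERIV_isCont[OF Dg] by (cases "z = 0") auto
  have g_ge: "1 \<le> g z" if "0 \<le> z" for z
  proof (cases "z = 0")
    case False
    have "K 0 - 0 \<le> K z - z"
      by (rule DERIV_nonneg_imp_nondecreasing[OF that])
        (use ge in \<open>auto intro!: exI derivative_eq_intros DK\<close>)
    then show ?thesis
      using False that by (simp add: g_eq K_def field_simps)
  qed (simp add: g0)
  define m where "m = (\<lambda>x. sqrt (g (x ^ 2)))"
  have m_cont: "isCont m x" for x
    unfolding m_def by (intro continuous_intros isCont_o2[OF _ g_cont])
  have m_ge: "1 \<le> m x" for x
    using g_ge[of "x ^ 2"] by (simp add: m_def)
  have m2: "m x * m x = g (x ^ 2)" for x
    using g_ge[of "x ^ 2"] by (simp add: m_def)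
  define u where "u = (\<lambda>x. x * m x)"
  define u' where "u' = (\<lambda>x. \<kappa> (x ^ 2) / m x)"
  have Du: "(u has_real_derivative u' x) (at x)" for x
  proof (cases "x = 0")
    case True
    have "m 0 = 1" by (simp add: m_def g0)
    then have "(u has_real_derivative 1) (at 0)"
      unfolding CARAT_DERIV using m_cont[of 0] by (intro exI[of _ m]) (simp add: u_def)
    then show ?thesis using True \<open>m 0 = 1\<close> by (simp add: u'_def \<kappa>0)
  next
    case False
    have "((\<lambda>x. g (x ^ 2)) has_real_derivative (\<kappa> (x ^ 2) - g (x ^ 2)) / x ^ 2 * (2 * x)) (at x)"
      by (rule DERIV_chain2[OF Dg]) (use False in \<open>auto intro!: derivative_eq_intros\<close>)
    moreover have "g (x ^ 2) > 0" using g_ge[of "x ^ 2"] by simp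
    ultimately have "(m has_real_derivative
        inverse (m x) / 2 * ((\<kappa> (x ^ 2) - g (x ^ 2)) / x ^ 2 * (2 * x))) (at x)"
      unfolding m_def by (intro DERIV_chain2[OF DERIV_real_sqrt])
    from DERIV_mult[OF DERIV_ident this]
    have "(u has_real_derivative 1 * m x +
        inverse (m x) / 2 * ((\<kappa> (x ^ 2) - g (x ^ 2)) / x ^ 2 * (2 * x)) * x) (at x)"
      by (simp add: u_def)
    moreover have "1 * m x +
        inverse (m x) / 2 * ((\<kappa> (x ^ 2) - g (x ^ 2)) / x ^ 2 * (2 * x)) * x = u' x"
      unfolding u'_def m2[symmetric] using False m_ge[of x]
      by (simp add: field_simps power2_eq_square)
    ultimately show ?thesis by simp
  qed
  show thesis
  proof (rule that[OF Du])
    show "0 < u' x" for x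
      using ge[of "x ^ 2"] m_ge[of x] by (simp add: u'_def)
    show "isCont u' x" for x
      unfolding u'_def using m_ge[of x]
      by (intro isCont_divide isCont_o2[OF _ cont] m_cont continuous_intros) auto
    show "u 0 = 0" by (simp add: u_def)
    show "u x * u' x = x * \<kappa> (x ^ 2)" for x
      using m_ge[of x] by (simp add: u_def u'_def)
    show "\<exists>x. s \<le> u x" for s
    proof
      show "s \<le> u \<bar>s\<bar>"
        using mult_left_mono[OF m_ge[of "\<bar>s\<bar>"], of "\<bar>s\<bar>"] by (simp add: u_def)
    qed
    show "\<exists>x. u x \<le> s" for s
    proof
      show "u (- \<bar>s\<bar>) \<le> s"
        using mult_left_mono[OF m_ge[of "- \<bar>s\<bar>"], of "\<bar>s\<bar>"] by (simp add: u_def)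
    qed
  qed
qed

text \<open>
  The potential G of the first integral has the derivative (x - a50 x^5) exp(-a32 x^4/2), which is
  x \<kappa> (x^2). The two sign conditions give \<kappa> \<ge> 1.
\<close>

lemma all_periodic_quintic:
  assumes "a32 \<le> 0" "a50 \<le> 0"
  shows "all_periodic (quintic_force 0 0 0 a32 0 a50)"
proof -
  define \<kappa> where "\<kappa> = (\<lambda>z::real. (1 - a50 * z ^ 2) * exp (- a32 * z ^ 2 / 2))"
  have "isCont \<kappa> z" for z
    unfolding \<kappa>_def by (intro continuous_intros) auto
  moreover have "1 \<le> \<kappa> z" for z
  proof -
    have le: "a50 * z ^ 2 \<le> 1"
      by (rule order_trans[OF mult_nonpos_nonneg[OF assms(2)]]) auto
    have "1 * 1 \<le> \<kappa> z"
      unfolding \<kappa>_def using assms le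
      by (intro mult_mono) (auto simp: mult_nonpos_nonneg)
    then show ?thesis by simp
  qed
  moreover have "\<kappa> 0 = 1" by (simp add: \<kappa>_def)
  ultimately obtain u u' where u: "\<And>x. (u has_real_derivative u' x) (at x)" "\<And>x. 0 < u' x"
      "\<And>x. isCont u' x" "u 0 = 0" "\<And>s. \<exists>x. u x \<le> s" "\<And>s. \<exists>x. s \<le> u x"
    and uu': "\<And>x. u x * u' x = x * \<kappa> (x ^ 2)"
    using square_root_coordinate[of \<kappa>] by blast
  define E where "E = (\<lambda>x::real. exp (- a32 * x ^ 4 / 4))"
  have E2: "E x ^ 2 = exp (- a32 * x ^ 4 / 2)" for x
    by (simp add: E_def exp_double[symmetric])
  show ?thesis
  proof (rule all_periodic_of_energy_coordinates[OF u, where E = E and e = "\<lambda>x. - a32 * x ^ 3"])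
    show "(E has_real_derivative - a32 * x ^ 3 * E x) (at x)" for x
      unfolding E_def by (auto intro!: derivative_eq_intros)
    show "0 < E x" for x by (simp add: E_def)
    show "quintic_force 0 0 0 a32 0 a50 x y = - (u x * u' x / E x ^ 2) - - a32 * x ^ 3 * y ^ 2" for x y
    proof -
      have "\<kappa> (x ^ 2) = (1 - a50 * x ^ 4) * E x ^ 2"
        by (simp add: \<kappa>_def E2 power_mult[symmetric])
      moreover have "E x \<noteq> 0" by (simp add: E_def)
      ultimately have "u x * u' x / E x ^ 2 = x * (1 - a50 * x ^ 4)"
        by (simp add: uu')
      then show ?thesis
        by (simp add: quintic_force_def algebra_simps eval_nat_numeral)
    qed
  qed
qed

section \<open>Global centers of the quintic system\<close>

theorem theorem1:
  fixes a05 a14 a23 a32 a41 a50 :: real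
  shows "is_global_center (quintic_field a05 a14 a23 a32 a41 a50) (0, 0) \<longleftrightarrow>
    a32 \<le> 0 \<and> a50 \<le> 0 \<and> a14 = 0 \<and> a41 = 0 \<and> a23 = 0 \<and> a05 = 0"
proof
  assume "is_global_center (quintic_field a05 a14 a23 a32 a41 a50) (0, 0)"
  then have "all_periodic (quintic_force a05 a14 a23 a32 a41 a50)"
    by (simp add: is_global_center_def all_periodic_def quintic_field_eq_newton)
  then show "a32 \<le> 0 \<and> a50 \<le> 0 \<and> a14 = 0 \<and> a41 = 0 \<and> a23 = 0 \<and> a05 = 0"
    by (rule all_periodic_quintic_coefficients)
next
  assume "a32 \<le> 0 \<and> a50 \<le> 0 \<and> a14 = 0 \<and> a41 = 0 \<and> a23 = 0 \<and> a05 = 0"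
  then have filled: "filled_with_periodic_orbits (quintic_field a05 a14 a23 a32 a41 a50) (UNIV - {(0, 0)})"
    using all_periodic_quintic by (simp add: all_periodic_def quintic_field_eq_newton)
  moreover have "quintic_field a05 a14 a23 a32 a41 a50 (0, 0) = 0"
    by (simp add: quintic_field_def zero_prod_def)
  ultimately show "is_global_center (quintic_field a05 a14 a23 a32 a41 a50) (0, 0)"
    unfolding is_global_center_def is_center_def by blast
qed

end
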